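(* Let $\mathbf{S}$ be a subcategory of the category $\mathbf{PMet}$ of pseudo-metric spaces, and suppose that $\mathbf{S}$ has non-trivial group actions (axiom (A1)) and bornological Cartesian powers (axioms (A2) and (A3)). Let $G$ and $H$ be two groups with $G$ non-trivial, and let $X$ be a set on which $H$ acts. Then the wreath product $G\wr_X H$ has property B$\mathbf{S}$ if and only if $G$ and $H$ have property B$\mathbf{S}$ and $X$ is finite.
   Context: Wreath product: for a group $G$ and a group $H$ acting on a set $X$, $\bigoplus_X G$ is the group of finitely supported functions $\varphi\colon X\to G$ with componentwise multiplication. The group $H$ acts by $(h.\varphi)(x)=\varphi(h^{-1}.x)$, and $G\wr_X H:=(\bigoplus_X G)\rtimes H$. A pseudo-metric space is a set $X$ with $d\colon X\times X\to\mathbf{R}_{\ge0}$ satisfying $d(x,x)=0$, symmetry and the triangle inequality. A short map is a distance non-increasing map. $\mathbf{PMet}$ is the category of pseudo-metric spaces with short maps. A subcategory $\mathbf{S}$ of $\mathbf{PMet}$ has pseudo-metric spaces as objects (called $\mathbf{S}$-spaces) and short maps as morphisms (not necessarily all of them). A $G$-action on an $\mathbf{S}$-space $X$ is a homomorphism $G\to\mathrm{Aut}_{\mathbf{S}}(X)$. A subset is bounded if its diameter is finite. A group $G$ has property B$\mathbf{S}$ if every $G$-action by $\mathbf{S}$-automorphisms on an $\mathbf{S}$-space has all its orbits bounded. Axiom (A1) (non-trivial group actions): for every non-trivial group $G$ there exist an $\mathbf{S}$-space $Y$ and an action of $G$ on $Y$ by $\mathbf{S}$-automorphisms moving at least one point.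 Axiom (A2): for any $\mathbf{S}$-space $X$ and any integer $n$ there is an $\mathbf{S}$-object $X^n$ such that: 1. as a set, $X^n$ is the $n$-th Cartesian power of $X$; 2. the canonical image of $\mathrm{Aut}_{\mathbf{S}}(X)^n\rtimes\mathrm{Sym}(n)$ in the group $\mathrm{Bij}(X^n)$ of bijections of $X^n$ lies in $\mathrm{Aut}_{\mathbf{S}}(X^n)$; 3. if $E\subset X$ is unbounded, then the diagonal $\mathrm{diag}(E)=\{(e,\dots,e) : e\in E\}\subset X^n$ is unbounded. Axiom (A3): for any $\mathbf{S}$-space $X$, any $x_0\in X$ and any infinite set $I$ there is an $\mathbf{S}$-object $\bigoplus_I^{\mathbf{S}}X$ such that, writing $\bigoplus_I X=\{f\in\prod_I X : f(i)=x_0\text{ for all but finitely many }i\}$: 1. as sets, $\bigoplus_I X\subseteq\bigoplus_I^{\mathbf{S}}X\subseteq\prod_I X$; 2. the canonical image of $\mathrm{Aut}_{\mathbf{S}}(X)\wr_I\mathrm{Sym}(I)$ in the group $\mathrm{Bij}(\prod_I X)$ of bijections of $\prod_I X$ lies in $\mathrm{Aut}_{\mathbf{S}}(\bigoplus_I^{\mathbf{S}}X)$, i.e. these bijections preserve $\bigoplus_I^{\mathbf{S}}X$ and restrict to $\mathbf{S}$-automorphisms of it; 3. for any $y\in X$ with $d(y,x_0)>0$, the set $\{f\in\bigoplus_I X : f(i)=y\text{ for finitely many }i\text{ and otherwise }f(i)=x_0\}$ has infinite diameter. $\mathbf{S}$ has bornological Cartesian powers if it satisfies both (A2) and (A3)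.
   Formalization: X is assumed non-empty (for X empty the wreath product is H and the claim fails), and in (A1) "moving at least one point" means moving it by a positive distance (spaces with zero pseudo-metric are otherwise a counterexample); in (A2), n is at least 1. *)

theory Defs
  imports
    "HOL-Algebra.Group_Action"
    "HOL-Algebra.Product_Groups"
    "HOL-Library.Extended_Nonnegative_Real"
begin

section \<open>Wreath products\<close>

definition semidirect_product ::
  "('n, 'm1) monoid_scheme \<Rightarrow> ('h, 'm2) monoid_scheme \<Rightarrow> ('h \<Rightarrow> 'n \<Rightarrow> 'n) \<Rightarrow> ('n \<times> 'h) monoid"
  where "semidirect_product N H \<theta> =
    \<lparr>carrier = carrier N \<times> carrier H,
     mult = (\<lambda>(a, h) (b, k). (a \<otimes>\<^bsub>N\<^esub> \<theta> h b, h \<otimes>\<^bsub>H\<^esub> k)),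
     one = (\<one>\<^bsub>N\<^esub>, \<one>\<^bsub>H\<^esub>)\<rparr>"

text \<open>The action $(h.\varphi)(x) = \varphi(h^{-1}.x)$ on functions defined on $X$, where \<open>\<alpha>\<close> is
  the action of $H$ on $X$.\<close>

definition shift_action ::
  "('h, 'm) monoid_scheme \<Rightarrow> 'x set \<Rightarrow> ('h \<Rightarrow> 'x \<Rightarrow> 'x) \<Rightarrow> 'h \<Rightarrow> ('x \<Rightarrow> 'g) \<Rightarrow> 'x \<Rightarrow> 'g"
  where "shift_action H X \<alpha> h \<phi> = (\<lambda>x\<in>X. \<phi> (\<alpha> (inv\<^bsub>H\<^esub> h) x))"

definition wreath_product ::
  "('g, 'm1) monoid_scheme \<Rightarrow> ('h, 'm2) monoid_scheme \<Rightarrow> 'x set \<Rightarrow> ('h \<Rightarrow> 'x \<Rightarrow> 'x)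
    \<Rightarrow> (('x \<Rightarrow> 'g) \<times> 'h) monoid"
  where "wreath_product G H X \<alpha> =
    semidirect_product (sum_group X (\<lambda>_. G)) H (shift_action H X \<alpha>)"


section \<open>Pseudo-metric spaces and subcategories of PMet\<close>

record 'a pmspace =
  pts :: "'a set"
  pdist :: "'a \<Rightarrow> 'a \<Rightarrow> real"

text \<open>The distance is required to be extensional, so that equality of records is equality of
  pseudo-metric spaces. Likewise, morphisms are extensional functions.\<close>

definition pseudo_metric_space :: "'a pmspace \<Rightarrow> bool"
  where "pseudo_metric_space Y \<longleftrightarrow>
    case_prod (pdist Y) \<in> extensional (pts Y \<times> pts Y) \<and>
    (\<forall>x\<in>pts Y. \<forall>y\<in>pts Y. 0 \<le> pdist Y x y) \<and>
    (\<forall>x\<in>pts Y. pdist Y x x = 0) \<and>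
    (\<forall>x\<in>pts Y. \<forall>y\<in>pts Y. pdist Y x y = pdist Y y x) \<and>
    (\<forall>x\<in>pts Y. \<forall>y\<in>pts Y. \<forall>z\<in>pts Y. pdist Y x z \<le> pdist Y x y + pdist Y y z)"

definition diam :: "'a pmspace \<Rightarrow> 'a set \<Rightarrow> ennreal"
  where "diam Y E = (SUP (x, y)\<in>E \<times> E. ennreal (pdist Y x y))"

definition bounded_in :: "'a pmspace \<Rightarrow> 'a set \<Rightarrow> bool"
  where "bounded_in Y E \<longleftrightarrow> diam Y E < \<infinity>"

definition short_maps :: "'a pmspace \<Rightarrow> 'a pmspace \<Rightarrow> ('a \<Rightarrow> 'a) set"
  where "short_maps Y Z =
    {f \<in> pts Y \<rightarrow>\<^sub>E pts Z. \<forall>x\<in>pts Y. \<forall>y\<in>pts Y. pdist Z (f x) (f y) \<le> pdist Y x y}"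

text \<open>The type \<open>'a\<close> plays the role of a universe of points; the objects are pseudo-metric spaces
  whose underlying set is contained in it.\<close>

record 'a pmet_cat =
  Obj :: "'a pmspace set"
  Mor :: "'a pmspace \<Rightarrow> 'a pmspace \<Rightarrow> ('a \<Rightarrow> 'a) set"

locale pmet_subcategory =
  fixes S :: "'a pmet_cat"
  assumes obj: "Y \<in> Obj S \<Longrightarrow> pseudo_metric_space Y"
    and mor: "\<lbrakk>Y \<in> Obj S; Z \<in> Obj S\<rbrakk> \<Longrightarrow> Mor S Y Z \<subseteq> short_maps Y Z"
    and id_mor: "Y \<in> Obj S \<Longrightarrow> (\<lambda>x\<in>pts Y. x) \<in> Mor S Y Y"
    and comp_mor: "\<lbrakk>Y \<in> Obj S; Z \<in> Obj S; W \<in> Obj S; f \<in> Mor S Y Z; g \<in> Mor S Z W\<rbrakk>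
                    \<Longrightarrow> compose (pts Y) g f \<in> Mor S Y W"

definition automorphisms :: "'a pmet_cat \<Rightarrow> 'a pmspace \<Rightarrow> ('a \<Rightarrow> 'a) set"
  where "automorphisms S Y =
    {f \<in> Mor S Y Y. \<exists>g\<in>Mor S Y Y.
       compose (pts Y) g f = (\<lambda>x\<in>pts Y. x) \<and> compose (pts Y) f g = (\<lambda>x\<in>pts Y. x)}"

definition aut_group :: "'a pmet_cat \<Rightarrow> 'a pmspace \<Rightarrow> ('a \<Rightarrow> 'a) monoid"
  where "aut_group S Y = BijGroup (pts Y) \<lparr>carrier := automorphisms S Y\<rparr>"

definition property_B :: "'a pmet_cat \<Rightarrow> ('g, 'm) monoid_scheme \<Rightarrow> bool"
  where "property_B S G \<longleftrightarrow>
    (\<forall>Y\<in>Obj S. \<forall>\<rho>\<in>hom G (aut_group S Y). \<forall>y\<in>pts Y. bounded_in Y (orbit G \<rho> y))"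


section \<open>The axioms\<close>

text \<open>Points are moved up to the pseudo-metric: the action has to displace some point by a positive
  distance. If this only said \<open>\<rho> g y \<noteq> y\<close>, the category of all spaces with zero pseudo-metric would
  satisfy all the axioms below, although every group has property B with respect to it.
  The type \<open>'g\<close> is the one over which the carriers of the groups range.\<close>

definition nontrivial_group_actions :: "'g itself \<Rightarrow> 'a pmet_cat \<Rightarrow> bool"
  where "nontrivial_group_actions _ S \<longleftrightarrow>
    (\<forall>G :: 'g monoid. group G \<and> carrier G \<noteq> {\<one>\<^bsub>G\<^esub>} \<longrightarrow>
       (\<exists>Y\<in>Obj S. \<exists>\<rho>\<in>hom G (aut_group S Y).
          \<exists>g\<in>carrier G. \<exists>y\<in>pts Y. pdist Y y (\<rho> g y) > 0))"

text \<open>The bijection of $M^I$ induced by a pair consisting of a family of bijections of $M$ and a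
  permutation of $I$.\<close>

definition power_bij :: "'i set \<Rightarrow> 'a set \<Rightarrow> ('i \<Rightarrow> 'a \<Rightarrow> 'a) \<times> ('i \<Rightarrow> 'i) \<Rightarrow> ('i \<Rightarrow> 'a) \<Rightarrow> ('i \<Rightarrow> 'a)"
  where "power_bij I M = (\<lambda>(\<phi>, \<sigma>). \<lambda>f\<in>I \<rightarrow>\<^sub>E M. \<lambda>i\<in>I. \<phi> i (f ((inv\<^bsub>BijGroup I\<^esub> \<sigma>) i)))"

definition transport :: "('b \<Rightarrow> 'a) \<Rightarrow> 'b set \<Rightarrow> ('b \<Rightarrow> 'b) \<Rightarrow> 'a \<Rightarrow> 'a"
  where "transport e Z F = (\<lambda>p\<in>e ` Z. e (F (inv_into Z e p)))"

text \<open>Families of points of an \<open>'a\<close>-space are not themselves elements of \<open>'a\<close>. Hence the statement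
  that the underlying set of an object \<open>P\<close> is a given set \<open>Z\<close> of families is expressed by a
  bijection \<open>e\<close> from \<open>Z\<close> onto the points of \<open>P\<close>, along which everything is transported.
  The exponent $n$ is positive: the diagonal of the one-point set $Y^0$ is always bounded.\<close>

definition finite_cartesian_powers :: "'a pmet_cat \<Rightarrow> bool"
  where "finite_cartesian_powers S \<longleftrightarrow>
    (\<forall>Y\<in>Obj S. \<forall>n::nat. n \<ge> 1 \<longrightarrow>
      (\<exists>P\<in>Obj S. \<exists>e.
         bij_betw e ({..<n} \<rightarrow>\<^sub>E pts Y) (pts P) \<and>
         (\<forall>k\<in>carrier (semidirect_product (product_group {..<n} (\<lambda>_. aut_group S Y))
                         (BijGroup {..<n}) (shift_action (BijGroup {..<n}) {..<n} (\<lambda>\<sigma>. \<sigma>))).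
            transport e ({..<n} \<rightarrow>\<^sub>E pts Y) (power_bij {..<n} (pts Y) k) \<in> automorphisms S P) \<and>
         (\<forall>E\<subseteq>pts Y. \<not> bounded_in Y E \<longrightarrow> \<not> bounded_in P (e ` (\<lambda>x. \<lambda>i\<in>{..<n}. x) ` E))))"

definition finsupp_power :: "'i set \<Rightarrow> 'a set \<Rightarrow> 'a \<Rightarrow> ('i \<Rightarrow> 'a) set"
  where "finsupp_power I M x0 = {f \<in> I \<rightarrow>\<^sub>E M. finite {i\<in>I. f i \<noteq> x0}}"

definition infinite_cartesian_powers :: "'i itself \<Rightarrow> 'a pmet_cat \<Rightarrow> bool"
  where "infinite_cartesian_powers _ S \<longleftrightarrow>
    (\<forall>Y\<in>Obj S. \<forall>x0\<in>pts Y. \<forall>I :: 'i set. infinite I \<longrightarrow>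
      (\<exists>P\<in>Obj S. \<exists>Z e.
         finsupp_power I (pts Y) x0 \<subseteq> Z \<and> Z \<subseteq> (I \<rightarrow>\<^sub>E pts Y) \<and> bij_betw e Z (pts P) \<and>
         (\<forall>k\<in>carrier (wreath_product (aut_group S Y) (BijGroup I) I (\<lambda>\<sigma>. \<sigma>)).
            power_bij I (pts Y) k ` Z = Z \<and>
            transport e Z (power_bij I (pts Y) k) \<in> automorphisms S P) \<and>
         (\<forall>y\<in>pts Y. pdist Y y x0 > 0 \<longrightarrow>
            diam P (e ` {f \<in> finsupp_power I (pts Y) x0.
                           finite {i\<in>I. f i = y} \<and> (\<forall>i\<in>I. f i = y \<or> f i = x0)}) = \<infinity>)))"

definition bornological_cartesian_powers :: "'i itself \<Rightarrow> 'a pmet_cat \<Rightarrow> bool"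
  where "bornological_cartesian_powers T S \<longleftrightarrow>
    finite_cartesian_powers S \<and> infinite_cartesian_powers T S"


section \<open>The groups involved are groups\<close>

lemma (in pmet_subcategory) automorphisms_subset_Bij:
  assumes "Y \<in> Obj S"
  shows "automorphisms S Y \<subseteq> Bij (pts Y)"
proof
  fix f assume "f \<in> automorphisms S Y"
  then obtain g where f: "f \<in> Mor S Y Y" and g: "g \<in> Mor S Y Y"
    and gf: "compose (pts Y) g f = (\<lambda>x\<in>pts Y. x)" and fg: "compose (pts Y) f g = (\<lambda>x\<in>pts Y. x)"
    unfolding automorphisms_def by blast
  have ff: "f \<in> pts Y \<rightarrow>\<^sub>E pts Y" and gg: "g \<in> pts Y \<rightarrow>\<^sub>E pts Y"
    using mor[OF assms assms] f g unfolding short_maps_def by auto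
  have "g (f x) = x" "f (g x) = x" if "x \<in> pts Y" for x
    using fun_cong[OF gf, of x] fun_cong[OF fg, of x] that by (simp_all add: compose_def)
  then have "bij_betw f (pts Y) (pts Y)"
    using ff gg by (intro bij_betw_byWitness[where f' = g]) auto
  then show "f \<in> Bij (pts Y)"
    using ff by (simp add: Bij_def PiE_def)
qed

lemma (in pmet_subcategory) group_aut_group:
  assumes "Y \<in> Obj S"
  shows "group (aut_group S Y)"
proof -
  note sub = automorphisms_subset_Bij[OF assms]
  have "subgroup (automorphisms S Y) (BijGroup (pts Y))"
  proof (rule group.subgroupI[OF group_BijGroup])
    show "automorphisms S Y \<subseteq> carrier (BijGroup (pts Y))"
      using sub by (simp add: BijGroup_def)
    have "(\<lambda>x\<in>pts Y. x) \<in> automorphisms S Y"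
      unfolding automorphisms_def using id_mor[OF assms]
      by (auto intro!: bexI[of _ "\<lambda>x\<in>pts Y. x"] simp: compose_def restrict_def fun_eq_iff)
    then show "automorphisms S Y \<noteq> {}" by blast
  next
    fix f assume f: "f \<in> automorphisms S Y"
    then obtain g where g: "f \<in> Mor S Y Y" "g \<in> Mor S Y Y"
      "compose (pts Y) g f = (\<lambda>x\<in>pts Y. x)" "compose (pts Y) f g = (\<lambda>x\<in>pts Y. x)"
      unfolding automorphisms_def by blast
    then have ga: "g \<in> automorphisms S Y"
      unfolding automorphisms_def by blast
    have "inv\<^bsub>BijGroup (pts Y)\<^esub> f = g"
      using sub f ga g by (intro group.inv_equality[OF group_BijGroup]) (auto simp: BijGroup_def)
    then show "inv\<^bsub>BijGroup (pts Y)\<^esub> f \<in> automorphisms S Y"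
      using ga by simp
  next
    fix a b assume a: "a \<in> automorphisms S Y" and b: "b \<in> automorphisms S Y"
    obtain a' where a': "a \<in> Mor S Y Y" "a' \<in> Mor S Y Y"
      "compose (pts Y) a' a = (\<lambda>x\<in>pts Y. x)" "compose (pts Y) a a' = (\<lambda>x\<in>pts Y. x)"
      using a unfolding automorphisms_def by blast
    obtain b' where b': "b \<in> Mor S Y Y" "b' \<in> Mor S Y Y"
      "compose (pts Y) b' b = (\<lambda>x\<in>pts Y. x)" "compose (pts Y) b b' = (\<lambda>x\<in>pts Y. x)"
      using b unfolding automorphisms_def by blast
    have closed: "u x \<in> pts Y" if "u \<in> Mor S Y Y" "x \<in> pts Y" for u x
      using mor[OF assms assms] that unfolding short_maps_def by auto
    have inverse: "a' (a x) = x" "a (a' x) = x" "b' (b x) = x" "b (b' x) = x"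
      if "x \<in> pts Y" for x
      using fun_cong[OF a'(3), of x] fun_cong[OF a'(4), of x]
        fun_cong[OF b'(3), of x] fun_cong[OF b'(4), of x] that by (simp_all add: compose_def)
    have "compose (pts Y) a b \<in> automorphisms S Y"
      unfolding automorphisms_def
    proof (rule CollectI, intro conjI bexI)
      show "compose (pts Y) a b \<in> Mor S Y Y" "compose (pts Y) b' a' \<in> Mor S Y Y"
        using comp_mor assms a' b' by blast+
      show "compose (pts Y) (compose (pts Y) b' a') (compose (pts Y) a b) = (\<lambda>x\<in>pts Y. x)"
        "compose (pts Y) (compose (pts Y) a b) (compose (pts Y) b' a') = (\<lambda>x\<in>pts Y. x)"
        using closed a'(1,2) b'(1,2) inverse by (auto simp: compose_def fun_eq_iff)
    qed
    then show "a \<otimes>\<^bsub>BijGroup (pts Y)\<^esub> b \<in> automorphisms S Y"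
      using sub a b by (auto simp: BijGroup_def)
  qed
  then show ?thesis
    unfolding aut_group_def by (rule group.subgroup_imp_group[OF group_BijGroup])
qed

lemma group_semidirect_product:
  assumes "group N" "group H"
    and closed: "\<And>h a. \<lbrakk>h \<in> carrier H; a \<in> carrier N\<rbrakk> \<Longrightarrow> \<theta> h a \<in> carrier N"
    and mult: "\<And>h a b. \<lbrakk>h \<in> carrier H; a \<in> carrier N; b \<in> carrier N\<rbrakk>
                 \<Longrightarrow> \<theta> h (a \<otimes>\<^bsub>N\<^esub> b) = \<theta> h a \<otimes>\<^bsub>N\<^esub> \<theta> h b"
    and comp: "\<And>h k a. \<lbrakk>h \<in> carrier H; k \<in> carrier H; a \<in> carrier N\<rbrakk>
                 \<Longrightarrow> \<theta> (h \<otimes>\<^bsub>H\<^esub> k) a = \<theta> h (\<theta> k a)"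
    and one: "\<And>a. a \<in> carrier N \<Longrightarrow> \<theta> \<one>\<^bsub>H\<^esub> a = a"
  shows "group (semidirect_product N H \<theta>)"
proof -
  interpret N: group N by fact
  interpret H: group H by fact
  show ?thesis
  proof (rule groupI)
    fix u assume "u \<in> carrier (semidirect_product N H \<theta>)"
    then obtain a h where u: "u = (a, h)" and a: "a \<in> carrier N" and h: "h \<in> carrier H"
      by (auto simp: semidirect_product_def)
    let ?v = "(\<theta> (inv\<^bsub>H\<^esub> h) (inv\<^bsub>N\<^esub> a), inv\<^bsub>H\<^esub> h)"
    have "\<theta> (inv\<^bsub>H\<^esub> h) \<one>\<^bsub>N\<^esub> = \<one>\<^bsub>N\<^esub>"
      using mult[of "inv\<^bsub>H\<^esub> h" "\<one>\<^bsub>N\<^esub>" "\<one>\<^bsub>N\<^esub>"] closed[of "inv\<^bsub>H\<^esub> h" "\<one>\<^bsub>N\<^esub>"] h by simp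
    then have "?v \<otimes>\<^bsub>semidirect_product N H \<theta>\<^esub> u = \<one>\<^bsub>semidirect_product N H \<theta>\<^esub>"
      using a h mult[of "inv\<^bsub>H\<^esub> h" "inv\<^bsub>N\<^esub> a" a] by (simp add: semidirect_product_def u)
    moreover have "?v \<in> carrier (semidirect_product N H \<theta>)"
      using a h closed by (simp add: semidirect_product_def)
    ultimately show "\<exists>v\<in>carrier (semidirect_product N H \<theta>).
        v \<otimes>\<^bsub>semidirect_product N H \<theta>\<^esub> u = \<one>\<^bsub>semidirect_product N H \<theta>\<^esub>"
      by blast
  qed (auto simp: semidirect_product_def closed mult comp one N.m_assoc H.m_assoc)
qed

lemma group_wreath_product:
  assumes "group G" "group_action H X \<alpha>"
  shows "group (wreath_product G H X \<alpha>)"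
proof -
  interpret act: group_action H X \<alpha> by fact
  interpret G: group G by fact
  interpret H: group H using act.group_hom group_hom.axioms(1) by blast
  have in_X: "\<alpha> h x \<in> X" if "h \<in> carrier H" "x \<in> X" for h x
    using act.element_image that by blast
  show ?thesis
    unfolding wreath_product_def
  proof (rule group_semidirect_product)
    show "group (sum_group X (\<lambda>_. G))" by (simp add: assms)
    show "group H" by (rule H.is_group)
  next
    fix h a assume h: "h \<in> carrier H" and a: "a \<in> carrier (sum_group X (\<lambda>_. G))"
    let ?A = "{x \<in> X. a x \<noteq> \<one>\<^bsub>G\<^esub>}"
    have "{x \<in> X. a (\<alpha> (inv\<^bsub>H\<^esub> h) x) \<noteq> \<one>\<^bsub>G\<^esub>} \<subseteq> \<alpha> h ` ?A"
    proof clarify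
      fix x assume x: "x \<in> X" "a (\<alpha> (inv\<^bsub>H\<^esub> h) x) \<noteq> \<one>\<^bsub>G\<^esub>"
      have "x = \<alpha> h (\<alpha> (inv\<^bsub>H\<^esub> h) x)"
        using act.orbit_sym_aux[of "inv\<^bsub>H\<^esub> h" x "\<alpha> (inv\<^bsub>H\<^esub> h) x"] h x by simp
      then show "x \<in> \<alpha> h ` ?A"
        using x h in_X by blast
    qed
    then have "finite {x \<in> X. a (\<alpha> (inv\<^bsub>H\<^esub> h) x) \<noteq> \<one>\<^bsub>G\<^esub>}"
      using a by (auto simp: carrier_sum_group assms intro: finite_subset)
    then show "shift_action H X \<alpha> h a \<in> carrier (sum_group X (\<lambda>_. G))"
      using a h in_X
      by (auto simp: carrier_sum_group assms shift_action_def cong: conj_cong)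
  next
    fix h a b
    assume "h \<in> carrier H"
    then show "shift_action H X \<alpha> h (a \<otimes>\<^bsub>sum_group X (\<lambda>_. G)\<^esub> b) =
      shift_action H X \<alpha> h a \<otimes>\<^bsub>sum_group X (\<lambda>_. G)\<^esub> shift_action H X \<alpha> h b"
      using in_X by (auto simp: shift_action_def fun_eq_iff)
  next
    fix h k a assume "h \<in> carrier H" "k \<in> carrier H"
    then show "shift_action H X \<alpha> (h \<otimes>\<^bsub>H\<^esub> k) a = shift_action H X \<alpha> h (shift_action H X \<alpha> k a)"
      using in_X act.composition_rule
      by (auto simp: shift_action_def fun_eq_iff H.inv_mult_group)
  next
    fix a assume "a \<in> carrier (sum_group X (\<lambda>_. G))"
    then have "a \<in> extensional X"
      by (simp add: carrier_sum_group assms PiE_def)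
    moreover have "\<alpha> \<one>\<^bsub>H\<^esub> x = x" if "x \<in> X" for x
      using fun_cong[OF act.id_eq_one, of x] that by simp
    ultimately show "shift_action H X \<alpha> \<one>\<^bsub>H\<^esub> a = a"
      by (auto simp: shift_action_def fun_eq_iff extensional_def)
  qed
qed

end

theory Submission
  imports Defs
begin

text \<open>
  Write \<open>W\<close> for the wreath product. An orbit of \<open>y\<close> is bounded if and only if the displacement
  \<open>w \<mapsto> d(y, w.y)\<close> is a bounded function on the group, and since group elements act by short maps
  this function is subadditive (\<open>displacement_mult\<close>). If \<open>X\<close> is finite, every element of \<open>W\<close> is a
  product of at most \<open>card X\<close> elements from the factors \<open>G\<close> and one element of \<open>H\<close>. When \<open>G\<close> and
  \<open>H\<close> have property B, the displacement is bounded on each of these subgroups, hence on \<open>W\<close>.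

  For the converse, \<open>H\<close> inherits property B as a quotient of \<open>W\<close>. Everything else rests on one
  construction: an action of \<open>G\<close> on \<open>Y\<close> makes \<open>W\<close> act on the power \<open>Y\<^sup>X\<close>, with \<open>G\<close>-valued functions
  acting coordinatewise and \<open>H\<close> permuting coordinates. The axioms on Cartesian powers say that this
  is an action by automorphisms of an object whose points are (some of) the families, and so the
  orbits of \<open>W\<close> there are bounded (\<open>property_B_wreath_product_power_bounded\<close>).

  If \<open>X\<close> were infinite, take an action of the non-trivial group \<open>G\<close> in which some \<open>g\<close> displaces
  a point \<open>x0\<close> by a positive distance. Starting at the family that is constantly \<open>x0\<close>, the finitely
  supported functions with values in \<open>{1, g}\<close> produce all families that take the value \<open>g.x0\<close>
  finitely often and \<open>x0\<close> elsewhere. The axiom on infinite powers gives these infinite diameter,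
  a contradiction. Once \<open>X\<close> is known to be finite, constant functions \<open>X \<rightarrow> G\<close> are elements of \<open>W\<close>;
  they move the diagonal point over \<open>y\<close> along the whole diagonal of the orbit \<open>G.y\<close>. By the axiom on
  finite powers this diagonal would be unbounded if \<open>G.y\<close> were.
\<close>

section \<open>Bounded orbits and displacement\<close>

lemma hom_aut_group_imp_group_action:
  assumes "pmet_subcategory S" "Y \<in> Obj S" "group G" "\<rho> \<in> hom G (aut_group S Y)"
  shows "group_action G (pts Y) \<rho>"
proof -
  interpret pmet_subcategory S by fact
  have "\<rho> \<in> hom G (BijGroup (pts Y))"
    using assms(4) automorphisms_subset_Bij[OF assms(2)]
    by (auto simp: hom_def aut_group_def BijGroup_def Pi_iff subset_iff)
  then show ?thesis
    by (simp add: group_action_def group_hom_def group_hom_axioms_def assms(3) group_BijGroup)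
qed

lemma bounded_in_subset:
  assumes "E \<subseteq> F" "bounded_in Y F"
  shows "bounded_in Y E"
proof -
  have "diam Y E \<le> diam Y F"
    unfolding diam_def using assms(1) by (intro SUP_subset_mono) auto
  then show ?thesis
    using assms(2) unfolding bounded_in_def by (rule le_less_trans)
qed

text \<open>Boundedness seen from a base point: the distance of two points of \<open>E\<close> is at most the sum of
  their distances to \<open>y\<close>.\<close>

lemma bounded_in_iff:
  assumes Y: "pseudo_metric_space Y" and "E \<subseteq> pts Y" "y \<in> E"
  shows "bounded_in Y E \<longleftrightarrow> (\<exists>C. \<forall>z\<in>E. pdist Y y z \<le> C)"
proof
  assume b: "bounded_in Y E"
  have "pdist Y y z \<le> enn2real (diam Y E)" if "z \<in> E" for z
  proof -
    have "ennreal (pdist Y y z) \<le> diam Y E"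
      unfolding diam_def using that assms(3)
      by (intro SUP_upper2[of "(y, z)"]) auto
    then have "enn2real (ennreal (pdist Y y z)) \<le> enn2real (diam Y E)"
      using b by (intro enn2real_mono) (auto simp: bounded_in_def)
    moreover have "0 \<le> pdist Y y z"
      using Y assms(2,3) that unfolding pseudo_metric_space_def by blast
    ultimately show ?thesis by simp
  qed
  then show "\<exists>C. \<forall>z\<in>E. pdist Y y z \<le> C" by blast
next
  assume "\<exists>C. \<forall>z\<in>E. pdist Y y z \<le> C"
  then obtain C where C: "\<And>z. z \<in> E \<Longrightarrow> pdist Y y z \<le> C" by blast
  have "pdist Y u v \<le> 2 * C" if "u \<in> E" "v \<in> E" for u v
  proof -
    have "pdist Y u v \<le> pdist Y u y + pdist Y y v" "pdist Y u y = pdist Y y u"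
      using Y assms(2,3) that unfolding pseudo_metric_space_def by blast+
    then show ?thesis using C[OF that(1)] C[OF that(2)] by linarith
  qed
  then have "diam Y E \<le> ennreal (2 * C)"
    unfolding diam_def by (intro SUP_least) (auto intro!: ennreal_leI)
  then show "bounded_in Y E"
    unfolding bounded_in_def by (rule le_less_trans) simp
qed

lemma bounded_orbit_iff:
  assumes S: "pmet_subcategory S" and Y: "Y \<in> Obj S" and G: "group G"
    and \<rho>: "\<rho> \<in> hom G (aut_group S Y)" and y: "y \<in> pts Y"
  shows "bounded_in Y (orbit G \<rho> y) \<longleftrightarrow> (\<exists>C. \<forall>g\<in>carrier G. pdist Y y (\<rho> g y) \<le> C)"
proof -
  interpret act: group_action G "pts Y" \<rho>
    using assms by (intro hom_aut_group_imp_group_action)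
  have "bounded_in Y (orbit G \<rho> y) \<longleftrightarrow> (\<exists>C. \<forall>z\<in>orbit G \<rho> y. pdist Y y z \<le> C)"
  proof (rule bounded_in_iff)
    show "pseudo_metric_space Y" using pmet_subcategory.obj[OF S Y] .
    show "orbit G \<rho> y \<subseteq> pts Y" using act.element_image y by (auto simp: orbit_def)
    show "y \<in> orbit G \<rho> y" using act.orbit_refl[OF y] .
  qed
  then show ?thesis by (auto simp: orbit_def)
qed

text \<open>The point \<open>gh.y\<close> is reached from \<open>y\<close> through \<open>g.y\<close>, and the short map \<open>g\<close> does not expand
  the distance from \<open>y\<close> to \<open>h.y\<close>.\<close>

lemma displacement_mult:
  assumes S: "pmet_subcategory S" and Y: "Y \<in> Obj S" and G: "group G"
    and \<rho>: "\<rho> \<in> hom G (aut_group S Y)" and y: "y \<in> pts Y"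
    and g: "g \<in> carrier G" and h: "h \<in> carrier G"
  shows "pdist Y y (\<rho> (g \<otimes>\<^bsub>G\<^esub> h) y) \<le> pdist Y y (\<rho> g y) + pdist Y y (\<rho> h y)"
proof -
  interpret pmet_subcategory S by fact
  interpret act: group_action G "pts Y" \<rho>
    using S Y G \<rho> by (intro hom_aut_group_imp_group_action)
  have gy: "\<rho> g y \<in> pts Y" and hy: "\<rho> h y \<in> pts Y" and ghy: "\<rho> g (\<rho> h y) \<in> pts Y"
    using act.element_image y g h by blast+
  have "\<rho> g \<in> short_maps Y Y"
    using \<rho> g mor[OF Y Y] by (auto simp: hom_def aut_group_def automorphisms_def)
  then have "pdist Y (\<rho> g y) (\<rho> g (\<rho> h y)) \<le> pdist Y y (\<rho> h y)"
    using y hy by (auto simp: short_maps_def)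
  moreover have "pdist Y y (\<rho> g (\<rho> h y)) \<le> pdist Y y (\<rho> g y) + pdist Y (\<rho> g y) (\<rho> g (\<rho> h y))"
    using obj[OF Y] y gy ghy unfolding pseudo_metric_space_def by blast
  ultimately show ?thesis
    using act.composition_rule[OF y g h] by simp
qed

text \<open>Property B of \<open>K\<close> is applied to the action pulled back along \<open>\<iota>\<close>. For an inclusion \<open>\<iota>\<close> this
  controls an action of a larger group on a subgroup; for a projection it yields the passage of
  property B to quotients.\<close>

lemma property_B_displacement_bounded:
  assumes S: "pmet_subcategory S" and K: "group K" and B: "property_B S K"
    and W: "group W" and \<iota>: "\<iota> \<in> hom K W"
    and Y: "Y \<in> Obj S" and \<rho>: "\<rho> \<in> hom W (aut_group S Y)" and y: "y \<in> pts Y"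
  shows "\<exists>C. \<forall>k\<in>carrier K. pdist Y y (\<rho> (\<iota> k) y) \<le> C"
proof -
  have \<rho>\<iota>: "\<rho> \<circ> \<iota> \<in> hom K (aut_group S Y)"
    using hom_compose[OF \<iota> \<rho>] .
  then have "bounded_in Y (orbit K (\<rho> \<circ> \<iota>) y)"
    using B Y y unfolding property_B_def by blast
  then show ?thesis
    using bounded_orbit_iff[OF S Y K \<rho>\<iota> y] by simp
qed

lemma property_B_quotient:
  assumes S: "pmet_subcategory S" and W: "group W" and Q: "group Q" and B: "property_B S W"
    and \<pi>: "\<pi> \<in> hom W Q" and surj: "carrier Q \<subseteq> \<pi> ` carrier W"
  shows "property_B S Q"
  unfolding property_B_def
proof (intro ballI)
  fix Y \<rho> y
  assume Y: "Y \<in> Obj S" and \<rho>: "\<rho> \<in> hom Q (aut_group S Y)" and y: "y \<in> pts Y"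
  obtain C where "\<forall>w\<in>carrier W. pdist Y y (\<rho> (\<pi> w) y) \<le> C"
    using property_B_displacement_bounded[OF S W B Q \<pi> Y \<rho> y] by blast
  then have "\<forall>q\<in>carrier Q. pdist Y y (\<rho> q y) \<le> C"
    using surj by blast
  then have "\<exists>C. \<forall>q\<in>carrier Q. pdist Y y (\<rho> q y) \<le> C" ..
  then show "bounded_in Y (orbit Q \<rho> y)"
    using bounded_orbit_iff[OF S Y Q \<rho> y] by simp
qed

section \<open>Wreath products over finite sets\<close>

lemma carrier_wreath_product:
  assumes "group G"
  shows "carrier (wreath_product G H X \<alpha>) =
    {a \<in> X \<rightarrow>\<^sub>E carrier G. finite {x\<in>X. a x \<noteq> \<one>\<^bsub>G\<^esub>}} \<times> carrier H"
  using assms by (simp add: wreath_product_def semidirect_product_def carrier_sum_group)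

lemma mult_wreath_product:
  "(a, h) \<otimes>\<^bsub>wreath_product G H X \<alpha>\<^esub> (b, k) =
    (\<lambda>x\<in>X. a x \<otimes>\<^bsub>G\<^esub> b (\<alpha> (inv\<^bsub>H\<^esub> h) x), h \<otimes>\<^bsub>H\<^esub> k)"
  by (auto simp: wreath_product_def semidirect_product_def shift_action_def)

lemma group_action_one:
  assumes "group_action H X \<alpha>" "x \<in> X"
  shows "\<alpha> \<one>\<^bsub>H\<^esub> x = x"
  using fun_cong[OF group_action.id_eq_one[OF assms(1)], of x] assms(2) by simp

lemma group_action_imp_group:
  assumes "group_action H X \<alpha>"
  shows "group H"
  using assms by (simp add: group_action_def group_hom_def)

lemma snd_hom_wreath_product:
  "snd \<in> hom (wreath_product G H X \<alpha>) H"
  by (auto simp: hom_def wreath_product_def semidirect_product_def)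

lemma hom_into_wreath_product_right:
  assumes G: "group G" and act: "group_action H X \<alpha>"
  shows "(\<lambda>h. (\<lambda>x\<in>X. \<one>\<^bsub>G\<^esub>, h)) \<in> hom H (wreath_product G H X \<alpha>)"
proof -
  interpret G: group G by fact
  interpret act: group_action H X \<alpha> by fact
  interpret H: group H using group_action_imp_group[OF act] .
  show ?thesis
  proof (rule homI)
    fix h k assume h: "h \<in> carrier H"
    show "(\<lambda>x\<in>X. \<one>\<^bsub>G\<^esub>, h) \<in> carrier (wreath_product G H X \<alpha>)"
      using h by (simp add: carrier_wreath_product G)
    have "\<alpha> (inv\<^bsub>H\<^esub> h) x \<in> X" if "x \<in> X" for x
      using act.element_image[of "inv\<^bsub>H\<^esub> h"] h that by blast
    then show "(\<lambda>x\<in>X. \<one>\<^bsub>G\<^esub>, h \<otimes>\<^bsub>H\<^esub> k) =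
        (\<lambda>x\<in>X. \<one>\<^bsub>G\<^esub>, h) \<otimes>\<^bsub>wreath_product G H X \<alpha>\<^esub> (\<lambda>x\<in>X. \<one>\<^bsub>G\<^esub>, k)"
      by (simp add: mult_wreath_product cong: restrict_cong)
  qed
qed

lemma hom_into_wreath_product_factor:
  assumes G: "group G" and act: "group_action H X \<alpha>" and x: "x \<in> X"
  shows "(\<lambda>g. (\<lambda>z\<in>X. if z = x then g else \<one>\<^bsub>G\<^esub>, \<one>\<^bsub>H\<^esub>)) \<in> hom G (wreath_product G H X \<alpha>)"
proof -
  interpret G: group G by fact
  interpret act: group_action H X \<alpha> by fact
  interpret H: group H using group_action_imp_group[OF act] .
  let ?\<delta> = "\<lambda>g. \<lambda>z\<in>X. if z = x then g else \<one>\<^bsub>G\<^esub>"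
  show ?thesis
  proof (rule homI)
    fix g k assume g: "g \<in> carrier G"
    have "finite {z\<in>X. ?\<delta> g z \<noteq> \<one>\<^bsub>G\<^esub>}"
      by (rule finite_subset[of _ "{x}"]) auto
    moreover have "?\<delta> g \<in> X \<rightarrow>\<^sub>E carrier G"
      using g by auto
    ultimately show "(?\<delta> g, \<one>\<^bsub>H\<^esub>) \<in> carrier (wreath_product G H X \<alpha>)"
      by (simp add: carrier_wreath_product G)
  next
    fix g k assume g: "g \<in> carrier G" and k: "k \<in> carrier G"
    have "?\<delta> (g \<otimes>\<^bsub>G\<^esub> k) z = (\<lambda>z\<in>X. ?\<delta> g z \<otimes>\<^bsub>G\<^esub> ?\<delta> k (\<alpha> (inv\<^bsub>H\<^esub> \<one>\<^bsub>H\<^esub>) z)) z" for z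
      using group_action_one[OF act] by simp
    then have "?\<delta> (g \<otimes>\<^bsub>G\<^esub> k) = (\<lambda>z\<in>X. ?\<delta> g z \<otimes>\<^bsub>G\<^esub> ?\<delta> k (\<alpha> (inv\<^bsub>H\<^esub> \<one>\<^bsub>H\<^esub>) z))" ..
    then show "(?\<delta> (g \<otimes>\<^bsub>G\<^esub> k), \<one>\<^bsub>H\<^esub>) =
        (?\<delta> g, \<one>\<^bsub>H\<^esub>) \<otimes>\<^bsub>wreath_product G H X \<alpha>\<^esub> (?\<delta> k, \<one>\<^bsub>H\<^esub>)"
      by (simp add: mult_wreath_product)
  qed
qed

text \<open>By subadditivity of the displacement it suffices to bound it on the subgroups \<open>G\<close> (one for
  each \<open>x \<in> X\<close>) and \<open>H\<close>, because every element is a product of a number of factors from them that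
  depends on \<open>card X\<close> only.\<close>

lemma property_B_wreath_product_finite:
  assumes S: "pmet_subcategory S" and G: "group G" and act: "group_action H X \<alpha>"
    and BG: "property_B S G" and BH: "property_B S H" and "finite X"
  shows "property_B S (wreath_product G H X \<alpha>)"
  unfolding property_B_def
proof (intro ballI)
  fix Y \<rho> y
  let ?W = "wreath_product G H X \<alpha>"
  assume Y: "Y \<in> Obj S" and \<rho>: "\<rho> \<in> hom ?W (aut_group S Y)" and y: "y \<in> pts Y"
  interpret G: group G by fact
  have H: "group H" using group_action_imp_group[OF act] .
  interpret H: group H by fact
  have W: "group ?W" using group_wreath_product[OF G act] .
  let ?L = "\<lambda>w. pdist Y y (\<rho> w y)"
  note L_mult = displacement_mult[OF S Y W \<rho> y]
  \<comment> \<open>The bound may depend on the support \<open>F\<close> but not on the function; it grows by the bound for one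
    copy of \<open>G\<close> whenever a point is added to \<open>F\<close>.\<close>
  have base: "\<exists>C. \<forall>a\<in>X \<rightarrow>\<^sub>E carrier G. (\<forall>x\<in>X - F. a x = \<one>\<^bsub>G\<^esub>) \<longrightarrow> ?L (a, \<one>\<^bsub>H\<^esub>) \<le> C"
    if "F \<subseteq> X" for F
    using finite_subset[OF that \<open>finite X\<close>] that
  proof (induction F rule: finite_induct)
    case empty
    have "a = (\<lambda>x\<in>X. \<one>\<^bsub>G\<^esub>)" if "a \<in> X \<rightarrow>\<^sub>E carrier G" "\<forall>x\<in>X - {}. a x = \<one>\<^bsub>G\<^esub>" for a
      using that by (auto simp: fun_eq_iff PiE_iff extensional_def)
    then show ?case
      by (intro exI[of _ "?L (\<lambda>x\<in>X. \<one>\<^bsub>G\<^esub>, \<one>\<^bsub>H\<^esub>)"]) auto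
  next
    case (insert x F)
    then obtain C where C: "\<And>a. \<lbrakk>a \<in> X \<rightarrow>\<^sub>E carrier G; \<forall>z\<in>X - F. a z = \<one>\<^bsub>G\<^esub>\<rbrakk>
        \<Longrightarrow> ?L (a, \<one>\<^bsub>H\<^esub>) \<le> C" by auto
    have x: "x \<in> X" using insert by simp
    let ?\<iota> = "\<lambda>g. (\<lambda>z\<in>X. if z = x then g else \<one>\<^bsub>G\<^esub>, \<one>\<^bsub>H\<^esub>)"
    have \<iota>: "?\<iota> \<in> hom G ?W" using hom_into_wreath_product_factor[OF G act x] .
    obtain D where D: "\<And>g. g \<in> carrier G \<Longrightarrow> ?L (?\<iota> g) \<le> D"
      using property_B_displacement_bounded[OF S G BG W \<iota> Y \<rho> y] by blast
    have "?L (a, \<one>\<^bsub>H\<^esub>) \<le> D + C"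
      if a: "a \<in> X \<rightarrow>\<^sub>E carrier G" and supp: "\<forall>z\<in>X - insert x F. a z = \<one>\<^bsub>G\<^esub>" for a
    proof -
      \<comment> \<open>Split off the value at \<open>x\<close>, leaving a function supported in \<open>F\<close>.\<close>
      let ?b = "\<lambda>z\<in>X. if z = x then \<one>\<^bsub>G\<^esub> else a z"
      have ax: "a x \<in> carrier G" using a x by blast
      have b: "?b \<in> X \<rightarrow>\<^sub>E carrier G" using a by auto
      have az: "\<And>z. z \<in> X \<Longrightarrow> a z \<in> carrier G" using a by blast
      have "?\<iota> (a x) \<otimes>\<^bsub>?W\<^esub> (?b, \<one>\<^bsub>H\<^esub>) = (a, \<one>\<^bsub>H\<^esub>)"
        using a az group_action_one[OF act]
        by (auto simp: mult_wreath_product fun_eq_iff PiE_iff extensional_def)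
      moreover have "?\<iota> (a x) \<in> carrier ?W" using hom_in_carrier[OF \<iota> ax] .
      moreover have "(?b, \<one>\<^bsub>H\<^esub>) \<in> carrier ?W"
        using b \<open>finite X\<close> by (simp add: carrier_wreath_product G)
      ultimately have "?L (a, \<one>\<^bsub>H\<^esub>) \<le> ?L (?\<iota> (a x)) + ?L (?b, \<one>\<^bsub>H\<^esub>)"
        using L_mult[of "?\<iota> (a x)" "(?b, \<one>\<^bsub>H\<^esub>)"] by simp
      moreover have "?L (?b, \<one>\<^bsub>H\<^esub>) \<le> C"
        using b supp by (intro C) auto
      ultimately show ?thesis using D[OF ax] by linarith
    qed
    then show ?case by blast
  qed
  obtain C where C: "\<And>a. a \<in> X \<rightarrow>\<^sub>E carrier G \<Longrightarrow> ?L (a, \<one>\<^bsub>H\<^esub>) \<le> C"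
    using base[of X] by auto
  let ?\<kappa> = "\<lambda>h. (\<lambda>x\<in>X. \<one>\<^bsub>G\<^esub>, h)"
  have \<kappa>: "?\<kappa> \<in> hom H ?W" using hom_into_wreath_product_right[OF G act] .
  obtain D where D: "\<And>h. h \<in> carrier H \<Longrightarrow> ?L (?\<kappa> h) \<le> D"
    using property_B_displacement_bounded[OF S H BH W \<kappa> Y \<rho> y] by blast
  have "?L w \<le> C + D" if w: "w \<in> carrier ?W" for w
  proof -
    obtain a h where wah: "w = (a, h)" and a: "a \<in> X \<rightarrow>\<^sub>E carrier G" and h: "h \<in> carrier H"
      using w by (auto simp: carrier_wreath_product G)
    have az: "\<And>z. z \<in> X \<Longrightarrow> a z \<in> carrier G" using a by blast
    have "(a, \<one>\<^bsub>H\<^esub>) \<otimes>\<^bsub>?W\<^esub> ?\<kappa> h = w"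
      using a az h group_action_one[OF act]
      by (auto simp: wah mult_wreath_product fun_eq_iff PiE_iff extensional_def)
    moreover have "(a, \<one>\<^bsub>H\<^esub>) \<in> carrier ?W"
      using a \<open>finite X\<close> by (simp add: carrier_wreath_product G)
    ultimately have "?L w \<le> ?L (a, \<one>\<^bsub>H\<^esub>) + ?L (?\<kappa> h)"
      using L_mult[of "(a, \<one>\<^bsub>H\<^esub>)" "?\<kappa> h"] hom_in_carrier[OF \<kappa> h] by simp
    then show ?thesis using C[OF a] D[OF h] by linarith
  qed
  then show "bounded_in Y (orbit ?W \<rho> y)"
    using bounded_orbit_iff[OF S Y W \<rho> y] by blast
qed

section \<open>Wreath products acting on powers\<close>

abbreviation power_group :: "'a pmet_cat \<Rightarrow> 'a pmspace \<Rightarrow> 'i set \<Rightarrow> (('i \<Rightarrow> 'a \<Rightarrow> 'a) \<times> ('i \<Rightarrow> 'i)) monoid"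
  where "power_group S Y I \<equiv> wreath_product (aut_group S Y) (BijGroup I) I (\<lambda>\<sigma>. \<sigma>)"

text \<open>Finite powers have the index set \<open>{..<n}\<close>, whereas in the wreath product the index
  set is \<open>X\<close>. The action on indices is therefore conjugated by a bijection \<open>b\<close> from \<open>I\<close> to \<open>X\<close>; for
  infinite \<open>X\<close> it will be the identity.\<close>

lemma transported_action_hom:
  assumes act: "group_action H X \<alpha>" and b: "bij_betw b I X"
  shows "(\<lambda>h. \<lambda>i\<in>I. inv_into I b (\<alpha> h (b i))) \<in> hom H (BijGroup I)"
proof -
  interpret act: group_action H X \<alpha> by fact
  interpret H: group H using group_action_imp_group[OF act] .
  let ?\<sigma> = "\<lambda>h. \<lambda>i\<in>I. inv_into I b (\<alpha> h (b i))"
  have b': "bij_betw (inv_into I b) X I" using bij_betw_inv_into[OF b] .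
  have Bij: "?\<sigma> h \<in> Bij I" if h: "h \<in> carrier H" for h
  proof -
    have \<alpha>h: "bij_betw (\<alpha> h) X X" using act.bij_prop0[OF h] by (simp add: Bij_def)
    have "bij_betw (?\<sigma> h) I I \<longleftrightarrow> bij_betw (inv_into I b \<circ> (\<alpha> h \<circ> b)) I I"
      by (rule bij_betw_cong) simp
    also have "\<dots>"
      using bij_betw_trans[OF bij_betw_trans[OF b \<alpha>h] b'] .
    finally have "bij_betw (?\<sigma> h) I I" .
    then show ?thesis by (simp add: Bij_def)
  qed
  show ?thesis
  proof (rule homI)
    show "?\<sigma> h \<in> carrier (BijGroup I)" if "h \<in> carrier H" for h
      using Bij[OF that] by (simp add: BijGroup_def)
    fix h k assume h: "h \<in> carrier H" and k: "k \<in> carrier H"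
    have "?\<sigma> (h \<otimes>\<^bsub>H\<^esub> k) i = compose I (?\<sigma> h) (?\<sigma> k) i" for i
    proof (cases "i \<in> I")
      case True
      then have bi: "b i \<in> X" using b by (auto simp: bij_betw_def)
      have kb: "\<alpha> k (b i) \<in> X" using act.element_image k bi by blast
      then have "inv_into I b (\<alpha> k (b i)) \<in> I" "b (inv_into I b (\<alpha> k (b i))) = \<alpha> k (b i)"
        using b by (auto simp: bij_betw_def inv_into_into f_inv_into_f)
      then show ?thesis
        using True act.composition_rule[OF bi h k] by (simp add: compose_def)
    qed (simp add: compose_def)
    then show "?\<sigma> (h \<otimes>\<^bsub>H\<^esub> k) = ?\<sigma> h \<otimes>\<^bsub>BijGroup I\<^esub> ?\<sigma> k"
      using Bij[OF h] Bij[OF k] by (auto simp: BijGroup_def)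
  qed
qed

text \<open>Functoriality of the wreath product: a homomorphism acts on the values, and a bijection
  relabels the indices. The permutation part is compatible with the shift because the inverse of the
  permutation induced by \<open>h\<close> is the one induced by \<open>inv h\<close>.\<close>

lemma wreath_product_hom:
  assumes G: "group G" and act: "group_action H X \<alpha>" and A: "group A"
    and \<rho>: "\<rho> \<in> hom G A" and b: "bij_betw b I X"
  shows "(\<lambda>(a, h). (\<lambda>i\<in>I. \<rho> (a (b i)), \<lambda>i\<in>I. inv_into I b (\<alpha> h (b i))))
    \<in> hom (wreath_product G H X \<alpha>) (wreath_product A (BijGroup I) I (\<lambda>\<sigma>. \<sigma>))"
proof -
  interpret act: group_action H X \<alpha> by fact
  interpret H: group H using group_action_imp_group[OF act] .
  interpret \<rho>: group_hom G A \<rho>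
    using G A \<rho> by (simp add: group_hom_def group_hom_axioms_def)
  let ?\<sigma> = "\<lambda>h. \<lambda>i\<in>I. inv_into I b (\<alpha> h (b i))"
  have \<sigma>: "?\<sigma> \<in> hom H (BijGroup I)" using transported_action_hom[OF act b] .
  interpret \<sigma>: group_hom H "BijGroup I" ?\<sigma>
    using \<sigma> H.is_group group_BijGroup by (simp add: group_hom_def group_hom_axioms_def)
  have bX: "b i \<in> X" if "i \<in> I" for i using b that by (auto simp: bij_betw_def)
  let ?f = "\<lambda>(a, h). (\<lambda>i\<in>I. \<rho> (a (b i)), ?\<sigma> h)"
  let ?W = "wreath_product G H X \<alpha>" and ?W' = "wreath_product A (BijGroup I) I (\<lambda>\<sigma>. \<sigma>)"
  show ?thesis
  proof (rule homI)
    fix w assume "w \<in> carrier ?W"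
    then obtain a h where w: "w = (a, h)" and a: "a \<in> X \<rightarrow>\<^sub>E carrier G"
      and fin: "finite {x \<in> X. a x \<noteq> \<one>\<^bsub>G\<^esub>}" and h: "h \<in> carrier H"
      by (auto simp: carrier_wreath_product G)
    have "finite {i\<in>I. a (b i) \<noteq> \<one>\<^bsub>G\<^esub>}"
    proof (rule inj_on_finite[OF _ _ fin])
      show "inj_on b {i\<in>I. a (b i) \<noteq> \<one>\<^bsub>G\<^esub>}"
        using b by (auto simp: bij_betw_def intro: inj_on_subset)
      show "b ` {i\<in>I. a (b i) \<noteq> \<one>\<^bsub>G\<^esub>} \<subseteq> {x \<in> X. a x \<noteq> \<one>\<^bsub>G\<^esub>}"
        using bX by auto
    qed
    then have "finite {i\<in>I. (\<lambda>i\<in>I. \<rho> (a (b i))) i \<noteq> \<one>\<^bsub>A\<^esub>}"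
      by (rule rev_finite_subset) auto
    moreover have "a (b i) \<in> carrier G" if "i \<in> I" for i
      using a bX[OF that] by blast
    ultimately show "?f w \<in> carrier ?W'"
      using \<sigma>.hom_closed[OF h] by (auto simp: w carrier_wreath_product A)
  next
    fix v w assume "v \<in> carrier ?W" "w \<in> carrier ?W"
    then obtain a h c k where v: "v = (a, h)" and w: "w = (c, k)"
      and a: "a \<in> X \<rightarrow>\<^sub>E carrier G" and h: "h \<in> carrier H"
      and c: "c \<in> X \<rightarrow>\<^sub>E carrier G" and k: "k \<in> carrier H"
      by (auto simp: carrier_wreath_product G)
    have "\<rho> (a (b i) \<otimes>\<^bsub>G\<^esub> c (\<alpha> (inv\<^bsub>H\<^esub> h) (b i))) =
        \<rho> (a (b i)) \<otimes>\<^bsub>A\<^esub> (\<lambda>j\<in>I. \<rho> (c (b j))) ((inv\<^bsub>BijGroup I\<^esub> (?\<sigma> h)) i)"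
      if i: "i \<in> I" for i
    proof -
      have hb: "\<alpha> (inv\<^bsub>H\<^esub> h) (b i) \<in> X"
        using act.element_image bX[OF i] h by blast
      have "(inv\<^bsub>BijGroup I\<^esub> (?\<sigma> h)) i = inv_into I b (\<alpha> (inv\<^bsub>H\<^esub> h) (b i))"
        using \<sigma>.hom_inv[OF h] i by (metis (no_types, lifting) restrict_apply')
      moreover have "inv_into I b (\<alpha> (inv\<^bsub>H\<^esub> h) (b i)) \<in> I"
        "b (inv_into I b (\<alpha> (inv\<^bsub>H\<^esub> h) (b i))) = \<alpha> (inv\<^bsub>H\<^esub> h) (b i)"
        using hb b by (auto simp: bij_betw_def inv_into_into f_inv_into_f)
      moreover have "a (b i) \<in> carrier G" "c (\<alpha> (inv\<^bsub>H\<^esub> h) (b i)) \<in> carrier G"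
        using a c bX[OF i] hb by blast+
      ultimately show ?thesis by simp
    qed
    moreover have "?\<sigma> (h \<otimes>\<^bsub>H\<^esub> k) = ?\<sigma> h \<otimes>\<^bsub>BijGroup I\<^esub> ?\<sigma> k"
      using \<sigma>.hom_mult[OF h k] .
    ultimately show "?f (v \<otimes>\<^bsub>?W\<^esub> w) = ?f v \<otimes>\<^bsub>?W'\<^esub> ?f w"
      using bX by (simp add: v w mult_wreath_product cong: restrict_cong)
  qed
qed

lemma mult_BijGroup:
  assumes "f \<in> Bij I" "g \<in> Bij I"
  shows "f \<otimes>\<^bsub>BijGroup I\<^esub> g = compose I f g"
  using assms by (simp add: BijGroup_def)

lemma inv_BijGroup_closed:
  assumes "\<sigma> \<in> carrier (BijGroup I)"
  shows "inv\<^bsub>BijGroup I\<^esub> \<sigma> \<in> Bij I"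
proof -
  have "carrier (BijGroup I) = Bij I" by (simp add: BijGroup_def)
  then show ?thesis using group.inv_closed[OF group_BijGroup assms] by simp
qed

lemma (in pmet_subcategory) automorphism_closed:
  assumes "Y \<in> Obj S" "f \<in> carrier (aut_group S Y)" "x \<in> pts Y"
  shows "f x \<in> pts Y"
  using automorphisms_subset_Bij[OF assms(1)] assms(2,3) Bij_imp_funcset
  by (fastforce simp: aut_group_def)

lemma (in pmet_subcategory) mult_aut_group:
  assumes "Y \<in> Obj S" "f \<in> carrier (aut_group S Y)" "g \<in> carrier (aut_group S Y)"
  shows "f \<otimes>\<^bsub>aut_group S Y\<^esub> g = compose (pts Y) f g"
  using automorphisms_subset_Bij[OF assms(1)] assms(2,3)
  by (auto simp: aut_group_def BijGroup_def)

lemma (in pmet_subcategory) power_bij_closed: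
  assumes Y: "Y \<in> Obj S" and k: "k \<in> carrier (power_group S Y I)" and f: "f \<in> I \<rightarrow>\<^sub>E pts Y"
  shows "power_bij I (pts Y) k f \<in> I \<rightarrow>\<^sub>E pts Y"
proof -
  obtain \<phi> \<sigma> where k_eq: "k = (\<phi>, \<sigma>)" by fastforce
  have \<phi>: "\<phi> \<in> I \<rightarrow>\<^sub>E carrier (aut_group S Y)" and \<sigma>: "\<sigma> \<in> carrier (BijGroup I)"
    using k by (auto simp: k_eq carrier_wreath_product group_aut_group Y)
  have "(inv\<^bsub>BijGroup I\<^esub> \<sigma>) i \<in> I" if "i \<in> I" for i
    using inv_BijGroup_closed[OF \<sigma>] that by (blast dest: Bij_imp_funcset)
  then have "f ((inv\<^bsub>BijGroup I\<^esub> \<sigma>) i) \<in> pts Y" if "i \<in> I" for i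
    using that f by blast
  moreover have "\<phi> i \<in> carrier (aut_group S Y)" if "i \<in> I" for i
    using \<phi> that by blast
  ultimately show ?thesis
    using automorphism_closed[OF Y] f by (simp add: k_eq power_bij_def)
qed

text \<open>Here the convention \<open>(h.\<phi>)(x) = \<phi>(h\<inverse>.x)\<close> of the semidirect product is matched with the
  inverse permutation in \<open>power_bij\<close>: for \<open>k = (\<phi>, \<sigma>)\<close> and \<open>l = (\<psi>, \<tau>)\<close>, at index \<open>i\<close> both sides evaluate \<open>f\<close> at
  \<open>\<tau>\<inverse>(\<sigma>\<inverse>(i))\<close> and then apply \<open>\<psi>\<close> at \<open>\<sigma>\<inverse>(i)\<close> and \<open>\<phi>\<close> at \<open>i\<close>.\<close>

lemma (in pmet_subcategory) power_bij_mult: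
  assumes Y: "Y \<in> Obj S" and k: "k \<in> carrier (power_group S Y I)"
    and l: "l \<in> carrier (power_group S Y I)" and f: "f \<in> I \<rightarrow>\<^sub>E pts Y"
  shows "power_bij I (pts Y) (k \<otimes>\<^bsub>power_group S Y I\<^esub> l) f =
    power_bij I (pts Y) k (power_bij I (pts Y) l f)"
proof -
  obtain \<phi> \<sigma> \<psi> \<tau> where kl: "k = (\<phi>, \<sigma>)" "l = (\<psi>, \<tau>)" by fastforce
  have \<phi>: "\<phi> \<in> I \<rightarrow>\<^sub>E carrier (aut_group S Y)" and \<sigma>: "\<sigma> \<in> carrier (BijGroup I)"
    and \<psi>: "\<psi> \<in> I \<rightarrow>\<^sub>E carrier (aut_group S Y)" and \<tau>: "\<tau> \<in> carrier (BijGroup I)"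
    using k l by (auto simp: kl carrier_wreath_product group_aut_group Y)
  let ?\<sigma>' = "inv\<^bsub>BijGroup I\<^esub> \<sigma>" and ?\<tau>' = "inv\<^bsub>BijGroup I\<^esub> \<tau>"
  have Bij: "?\<sigma>' \<in> Bij I" "?\<tau>' \<in> Bij I"
    using inv_BijGroup_closed \<sigma> \<tau> by blast+
  then have I: "?\<sigma>' i \<in> I" "?\<tau>' i \<in> I" if "i \<in> I" for i
    using that Bij_imp_funcset by blast+
  have inv: "inv\<^bsub>BijGroup I\<^esub> (\<sigma> \<otimes>\<^bsub>BijGroup I\<^esub> \<tau>) = compose I ?\<tau>' ?\<sigma>'"
    using group.inv_mult_group[OF group_BijGroup \<sigma> \<tau>] mult_BijGroup[OF Bij(2,1)] by simp
  have "(\<phi> i \<otimes>\<^bsub>aut_group S Y\<^esub> \<psi> (?\<sigma>' i)) (f (compose I ?\<tau>' ?\<sigma>' i)) =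
      \<phi> i (\<psi> (?\<sigma>' i) (f (?\<tau>' (?\<sigma>' i))))" if i: "i \<in> I" for i
  proof -
    have "\<phi> i \<in> carrier (aut_group S Y)" "\<psi> (?\<sigma>' i) \<in> carrier (aut_group S Y)"
      using \<phi> \<psi> i I by blast+
    moreover have "f (?\<tau>' (?\<sigma>' i)) \<in> pts Y"
      using f I i by blast
    ultimately show ?thesis
      using i by (simp add: mult_aut_group[OF Y] compose_def)
  qed
  moreover have "power_bij I (pts Y) l f \<in> I \<rightarrow>\<^sub>E pts Y"
    using power_bij_closed[OF Y l f] .
  ultimately show ?thesis
    using f I by (simp add: kl mult_wreath_product power_bij_def inv cong: restrict_cong)
qed

text \<open>The axioms only provide, element by element, automorphisms of \<open>P\<close>; for property B they have to
  be assembled into a homomorphism. This is where invariance of \<open>Z\<close> enters, since otherwise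
  transporting along \<open>e\<close> would not commute with composition.\<close>

lemma (in pmet_subcategory) transport_power_bij_hom:
  assumes Y: "Y \<in> Obj S" and P: "P \<in> Obj S"
    and Z: "Z \<subseteq> I \<rightarrow>\<^sub>E pts Y" and e: "bij_betw e Z (pts P)"
    and inv: "\<And>k. k \<in> carrier (power_group S Y I) \<Longrightarrow> power_bij I (pts Y) k ` Z \<subseteq> Z"
    and aut: "\<And>k. k \<in> carrier (power_group S Y I) \<Longrightarrow>
      transport e Z (power_bij I (pts Y) k) \<in> automorphisms S P"
  shows "(\<lambda>k. transport e Z (power_bij I (pts Y) k)) \<in> hom (power_group S Y I) (aut_group S P)"
proof (rule homI)
  fix k assume "k \<in> carrier (power_group S Y I)"
  then show "transport e Z (power_bij I (pts Y) k) \<in> carrier (aut_group S P)"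
    using aut by (simp add: aut_group_def)
next
  fix k l assume k: "k \<in> carrier (power_group S Y I)" and l: "l \<in> carrier (power_group S Y I)"
  let ?t = "\<lambda>k. transport e Z (power_bij I (pts Y) k)"
  have e_inj: "inj_on e Z" and e_img: "pts P = e ` Z" using e by (auto simp: bij_betw_def)
  have t_e: "?t m (e z) = e (power_bij I (pts Y) m z)" if "z \<in> Z" for m z
    using that e_inj by (simp add: transport_def)
  have "?t (k \<otimes>\<^bsub>power_group S Y I\<^esub> l) p = compose (pts P) (?t k) (?t l) p" for p
  proof (cases "p \<in> e ` Z")
    case True
    then obtain z where z: "z \<in> Z" "p = e z" by blast
    have "power_bij I (pts Y) l z \<in> Z" using inv[OF l] z(1) by blast
    then show ?thesis
      using z Z power_bij_mult[OF Y k l, of z] by (auto simp: compose_def e_img t_e)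
  qed (simp add: transport_def compose_def e_img)
  then have "?t (k \<otimes>\<^bsub>power_group S Y I\<^esub> l) = compose (pts P) (?t k) (?t l)" ..
  also have "\<dots> = ?t k \<otimes>\<^bsub>aut_group S P\<^esub> ?t l"
    using mult_aut_group[OF P] aut[OF k] aut[OF l] by (simp add: aut_group_def)
  finally show "?t (k \<otimes>\<^bsub>power_group S Y I\<^esub> l) = ?t k \<otimes>\<^bsub>aut_group S P\<^esub> ?t l" .
qed

text \<open>The common source of both contradictions below: the wreath product acts on \<open>P\<close>, and the set
  considered here is contained in the orbit of \<open>e f\<close>, namely in the part of it reached by the
  elements with trivial component in \<open>H\<close>.\<close>

lemma property_B_wreath_product_power_bounded:
  assumes S: "pmet_subcategory S" and G: "group G" and act: "group_action H X \<alpha>"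
    and B: "property_B S (wreath_product G H X \<alpha>)"
    and Y: "Y \<in> Obj S" and \<rho>: "\<rho> \<in> hom G (aut_group S Y)" and b: "bij_betw b I X"
    and P: "P \<in> Obj S" and Z: "Z \<subseteq> I \<rightarrow>\<^sub>E pts Y" and e: "bij_betw e Z (pts P)"
    and inv: "\<And>k. k \<in> carrier (power_group S Y I) \<Longrightarrow> power_bij I (pts Y) k ` Z \<subseteq> Z"
    and aut: "\<And>k. k \<in> carrier (power_group S Y I) \<Longrightarrow>
      transport e Z (power_bij I (pts Y) k) \<in> automorphisms S P"
    and f: "f \<in> Z"
  shows "bounded_in P (e ` {\<lambda>i\<in>I. \<rho> (a (b i)) (f i) | a.
      a \<in> X \<rightarrow>\<^sub>E carrier G \<and> finite {x\<in>X. a x \<noteq> \<one>\<^bsub>G\<^esub>}})"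
proof -
  interpret pmet_subcategory S by fact
  interpret act: group_action H X \<alpha> by fact
  interpret H: group H using group_action_imp_group[OF act] .
  let ?W = "wreath_product G H X \<alpha>"
  let ?\<sigma> = "\<lambda>h. \<lambda>i\<in>I. inv_into I b (\<alpha> h (b i))"
  let ?\<kappa> = "\<lambda>(a, h). (\<lambda>i\<in>I. \<rho> (a (b i)), ?\<sigma> h)"
  let ?t = "\<lambda>k. transport e Z (power_bij I (pts Y) k)"
  have \<kappa>: "?\<kappa> \<in> hom ?W (power_group S Y I)"
    using wreath_product_hom[OF G act group_aut_group[OF Y] \<rho> b] .
  have "?t \<circ> ?\<kappa> \<in> hom ?W (aut_group S P)"
    using hom_compose[OF \<kappa> transport_power_bij_hom[OF Y P Z e inv aut]] by simp
  moreover have "e f \<in> pts P" using e f by (auto simp: bij_betw_def)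
  ultimately have bdd: "bounded_in P (orbit ?W (?t \<circ> ?\<kappa>) (e f))"
    using B P unfolding property_B_def by blast
  have \<sigma>_one: "?\<sigma> \<one>\<^bsub>H\<^esub> = \<one>\<^bsub>BijGroup I\<^esub>"
    using hom_one[OF transported_action_hom[OF act b] H.is_group group_BijGroup] .
  have inv_one: "inv\<^bsub>BijGroup I\<^esub> (?\<sigma> \<one>\<^bsub>H\<^esub>) = (\<lambda>i\<in>I. i)"
    unfolding \<sigma>_one
    using monoid.inv_one[OF group.is_monoid[OF group_BijGroup]] by (simp add: BijGroup_def)
  have "e (\<lambda>i\<in>I. \<rho> (a (b i)) (f i)) \<in> orbit ?W (?t \<circ> ?\<kappa>) (e f)"
    if a: "a \<in> X \<rightarrow>\<^sub>E carrier G" "finite {x\<in>X. a x \<noteq> \<one>\<^bsub>G\<^esub>}" for a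
  proof -
    have "f \<in> I \<rightarrow>\<^sub>E pts Y" using f Z by blast
    then have "power_bij I (pts Y) (?\<kappa> (a, \<one>\<^bsub>H\<^esub>)) f = (\<lambda>i\<in>I. \<rho> (a (b i)) (f i))"
      using inv_one by (simp add: power_bij_def cong: restrict_cong)
    then have "e (\<lambda>i\<in>I. \<rho> (a (b i)) (f i)) = (?t \<circ> ?\<kappa>) (a, \<one>\<^bsub>H\<^esub>) (e f)"
      using f e by (auto simp: transport_def bij_betw_def)
    moreover have "(a, \<one>\<^bsub>H\<^esub>) \<in> carrier ?W"
      using a by (simp add: carrier_wreath_product G)
    ultimately show ?thesis unfolding orbit_def by blast
  qed
  then show ?thesis
    by (intro bounded_in_subset[OF _ bdd]) blast
qed

section \<open>Consequences of property B for the wreath product\<close>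

text \<open>In an infinite power, families with finitely many coordinates moved from \<open>x0\<close> to a point at
  positive distance are arbitrarily far apart, yet all of them lie in one orbit of the wreath
  product.\<close>

lemma finite_if_property_B_wreath_product:
  fixes S :: "'a pmet_cat" and G :: "'g monoid" and X :: "'x set"
  assumes S: "pmet_subcategory S" and A1: "nontrivial_group_actions TYPE('g) S"
    and A3: "infinite_cartesian_powers TYPE('x) S"
    and G: "group G" and nontrivial: "carrier G \<noteq> {\<one>\<^bsub>G\<^esub>}" and act: "group_action H X \<alpha>"
    and B: "property_B S (wreath_product G H X \<alpha>)"
  shows "finite X"
proof (rule ccontr)
  assume inf: "infinite X"
  interpret pmet_subcategory S by fact
  interpret G: group G by fact
  obtain Y \<rho> g x0 where Y: "Y \<in> Obj S" and \<rho>: "\<rho> \<in> hom G (aut_group S Y)"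
    and g: "g \<in> carrier G" and x0: "x0 \<in> pts Y" and moved: "pdist Y x0 (\<rho> g x0) > 0"
    using A1 G nontrivial unfolding nontrivial_group_actions_def by blast
  interpret \<rho>: group_action G "pts Y" \<rho>
    using hom_aut_group_imp_group_action[OF S Y G \<rho>] .
  let ?y = "\<rho> g x0"
  have y: "?y \<in> pts Y" using \<rho>.element_image g x0 by blast
  have "pdist Y ?y x0 = pdist Y x0 ?y"
    using obj[OF Y] x0 y unfolding pseudo_metric_space_def by blast
  then have pos: "pdist Y ?y x0 > 0" using moved by simp
  obtain P Z e where P: "P \<in> Obj S" and fin_Z: "finsupp_power X (pts Y) x0 \<subseteq> Z"
    and Z: "Z \<subseteq> X \<rightarrow>\<^sub>E pts Y" and e: "bij_betw e Z (pts P)"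
    and aut: "\<And>k. k \<in> carrier (power_group S Y X) \<Longrightarrow>
       power_bij X (pts Y) k ` Z = Z \<and> transport e Z (power_bij X (pts Y) k) \<in> automorphisms S P"
    and diam: "diam P (e ` {f \<in> finsupp_power X (pts Y) x0.
       finite {i\<in>X. f i = ?y} \<and> (\<forall>i\<in>X. f i = ?y \<or> f i = x0)}) = \<infinity>"
  proof -
    from A3[unfolded infinite_cartesian_powers_def, THEN bspec, OF Y, THEN bspec, OF x0,
        THEN spec, THEN mp, OF inf]
    show thesis
    proof (elim bexE exE conjE)
      fix P Z e
      assume "P \<in> Obj S" "finsupp_power X (pts Y) x0 \<subseteq> Z" "Z \<subseteq> X \<rightarrow>\<^sub>E pts Y"
        "bij_betw e Z (pts P)"
        and aut: "\<forall>k\<in>carrier (power_group S Y X). power_bij X (pts Y) k ` Z = Z \<and>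
          transport e Z (power_bij X (pts Y) k) \<in> automorphisms S P"
        and diam: "\<forall>y\<in>pts Y. pdist Y y x0 > 0 \<longrightarrow>
          diam P (e ` {f \<in> finsupp_power X (pts Y) x0.
            finite {i\<in>X. f i = y} \<and> (\<forall>i\<in>X. f i = y \<or> f i = x0)}) = \<infinity>"
      then show thesis
        by (intro that[OF _ _ _ _ bspec[OF aut] mp[OF bspec[OF diam y] pos]])
    qed
  qed
  let ?E = "{f \<in> finsupp_power X (pts Y) x0.
       finite {i\<in>X. f i = ?y} \<and> (\<forall>i\<in>X. f i = ?y \<or> f i = x0)}"
  let ?c = "\<lambda>x\<in>X. x0"
  have c: "?c \<in> Z"
    using x0 by (intro subsetD[OF fin_Z]) (auto simp: finsupp_power_def cong: conj_cong)
  have bdd: "bounded_in P (e ` {\<lambda>i\<in>X. \<rho> (a (id i)) (?c i) | a.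
      a \<in> X \<rightarrow>\<^sub>E carrier G \<and> finite {x\<in>X. a x \<noteq> \<one>\<^bsub>G\<^esub>}})"
    using aut by (intro property_B_wreath_product_power_bounded
        [OF S G act B Y \<rho> bij_betw_id P Z e _ _ c]) auto
  have "f \<in> {\<lambda>i\<in>X. \<rho> (a (id i)) (?c i) | a.
      a \<in> X \<rightarrow>\<^sub>E carrier G \<and> finite {x\<in>X. a x \<noteq> \<one>\<^bsub>G\<^esub>}}" if f: "f \<in> ?E" for f
  proof -
    \<comment> \<open>The function that is \<open>g\<close> where \<open>f\<close> takes the value \<open>g.x0\<close> carries the constant family to \<open>f\<close>.\<close>
    let ?a = "\<lambda>i\<in>X. if f i = ?y then g else \<one>\<^bsub>G\<^esub>"
    have "f i = (\<lambda>i\<in>X. \<rho> (?a (id i)) (?c i)) i" for i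
      using f group_action_one[OF \<rho>.group_action_axioms x0]
      by (auto simp: finsupp_power_def PiE_iff extensional_def)
    then have "f = (\<lambda>i\<in>X. \<rho> (?a (id i)) (?c i))" ..
    moreover have "finite {i\<in>X. ?a i \<noteq> \<one>\<^bsub>G\<^esub>}"
      using f by (auto intro: rev_finite_subset[of "{i\<in>X. f i = ?y}"])
    moreover have "?a \<in> X \<rightarrow>\<^sub>E carrier G" using g by auto
    ultimately show ?thesis by blast
  qed
  then have "bounded_in P (e ` ?E)"
    by (intro bounded_in_subset[OF _ bdd] image_mono) blast
  then show False using diam by (simp add: bounded_in_def)
qed

text \<open>A finite power detects unboundedness on its diagonal, and over a finite set \<open>X\<close> the constant
  functions belong to the direct sum, so that the diagonal of a \<open>G\<close>-orbit lies in an orbit of the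
  wreath product. Non-emptiness of \<open>X\<close> is essential: otherwise the wreath product is just \<open>H\<close>.\<close>

lemma property_B_left_if_property_B_wreath_product:
  assumes S: "pmet_subcategory S" and A2: "finite_cartesian_powers S"
    and G: "group G" and act: "group_action H X \<alpha>" and X: "finite X" "X \<noteq> {}"
    and B: "property_B S (wreath_product G H X \<alpha>)"
  shows "property_B S G"
  unfolding property_B_def
proof (intro ballI, rule ccontr)
  fix Y \<rho> y
  assume Y: "Y \<in> Obj S" and \<rho>: "\<rho> \<in> hom G (aut_group S Y)" and y: "y \<in> pts Y"
    and unbdd: "\<not> bounded_in Y (orbit G \<rho> y)"
  interpret pmet_subcategory S by fact
  interpret \<rho>: group_action G "pts Y" \<rho>
    using hom_aut_group_imp_group_action[OF S Y G \<rho>] .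
  let ?n = "card X" and ?I = "{..<card X}"
  obtain b where b: "bij_betw b ?I X"
    using ex_bij_betw_nat_finite[OF X(1)] by (auto simp: atLeast0LessThan)
  have n: "?n \<ge> 1" using X by (simp add: Suc_le_eq card_gt_0_iff)
  obtain P e where P: "P \<in> Obj S" and e: "bij_betw e (?I \<rightarrow>\<^sub>E pts Y) (pts P)"
    and aut: "\<And>k. k \<in> carrier (semidirect_product (product_group ?I (\<lambda>_. aut_group S Y))
          (BijGroup ?I) (shift_action (BijGroup ?I) ?I (\<lambda>\<sigma>. \<sigma>))) \<Longrightarrow>
        transport e (?I \<rightarrow>\<^sub>E pts Y) (power_bij ?I (pts Y) k) \<in> automorphisms S P"
    and diag: "\<And>E. \<lbrakk>E \<subseteq> pts Y; \<not> bounded_in Y E\<rbrakk> \<Longrightarrow>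
        \<not> bounded_in P (e ` (\<lambda>x. \<lambda>i\<in>?I. x) ` E)"
  proof -
    from A2[unfolded finite_cartesian_powers_def, THEN bspec, OF Y, THEN spec, THEN mp, OF n]
    show thesis
    proof (elim bexE exE conjE)
      fix P e
      assume "P \<in> Obj S" "bij_betw e (?I \<rightarrow>\<^sub>E pts Y) (pts P)"
        and aut: "\<forall>k\<in>carrier (semidirect_product (product_group ?I (\<lambda>_. aut_group S Y))
            (BijGroup ?I) (shift_action (BijGroup ?I) ?I (\<lambda>\<sigma>. \<sigma>))).
          transport e (?I \<rightarrow>\<^sub>E pts Y) (power_bij ?I (pts Y) k) \<in> automorphisms S P"
        and diag: "\<forall>E\<subseteq>pts Y. \<not> bounded_in Y E \<longrightarrow> \<not> bounded_in P (e ` (\<lambda>x. \<lambda>i\<in>?I. x) ` E)"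
      then show thesis
        using that[OF _ _ bspec[OF aut]] by blast
    qed
  qed
  \<comment> \<open>On a finite index set the direct sum is the full product, so that the wreath product of
    \<open>Aut(Y)\<close> with the symmetric group has the same elements as the group of the axiom.\<close>
  have aut': "transport e (?I \<rightarrow>\<^sub>E pts Y) (power_bij ?I (pts Y) k) \<in> automorphisms S P"
    if "k \<in> carrier (power_group S Y ?I)" for k
    using that by (intro aut) (auto simp: carrier_wreath_product group_aut_group[OF Y]
        semidirect_product_def)
  let ?c = "\<lambda>i\<in>?I. y"
  have c: "?c \<in> ?I \<rightarrow>\<^sub>E pts Y" using y by auto
  have bdd: "bounded_in P (e ` {\<lambda>i\<in>?I. \<rho> (a (b i)) (?c i) | a.
      a \<in> X \<rightarrow>\<^sub>E carrier G \<and> finite {x\<in>X. a x \<noteq> \<one>\<^bsub>G\<^esub>}})"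
    using property_B_wreath_product_power_bounded[OF S G act B Y \<rho> b P subset_refl e
        image_subsetI[OF power_bij_closed[OF Y]] aut' c] .
  have "(\<lambda>i\<in>?I. \<rho> g y) \<in> {\<lambda>i\<in>?I. \<rho> (a (b i)) (?c i) | a.
      a \<in> X \<rightarrow>\<^sub>E carrier G \<and> finite {x\<in>X. a x \<noteq> \<one>\<^bsub>G\<^esub>}}" if g: "g \<in> carrier G" for g
  proof -
    have "b i \<in> X" if "i \<in> ?I" for i using b that by (auto simp: bij_betw_def)
    then have "(\<lambda>i\<in>?I. \<rho> g y) = (\<lambda>i\<in>?I. \<rho> ((\<lambda>x\<in>X. g) (b i)) (?c i))"
      by (intro restrict_ext) simp
    moreover have "(\<lambda>x\<in>X. g) \<in> X \<rightarrow>\<^sub>E carrier G" using g by auto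
    moreover have "finite {x\<in>X. (\<lambda>x\<in>X. g) x \<noteq> \<one>\<^bsub>G\<^esub>}" using X(1) by simp
    ultimately show ?thesis
      by (intro CollectI exI[of _ "\<lambda>x\<in>X. g"] conjI)
  qed
  then have "(\<lambda>x. \<lambda>i\<in>?I. x) ` orbit G \<rho> y \<subseteq> {\<lambda>i\<in>?I. \<rho> (a (b i)) (?c i) | a.
      a \<in> X \<rightarrow>\<^sub>E carrier G \<and> finite {x\<in>X. a x \<noteq> \<one>\<^bsub>G\<^esub>}}"
    unfolding orbit_def by blast
  then have "bounded_in P (e ` (\<lambda>x. \<lambda>i\<in>?I. x) ` orbit G \<rho> y)"
    by (intro bounded_in_subset[OF _ bdd] image_mono)
  moreover have "orbit G \<rho> y \<subseteq> pts Y"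
    using \<rho>.element_image y by (auto simp: orbit_def)
  ultimately show False using diag unbdd by blast
qed

theorem theorem3p1:
  fixes S :: "'a pmet_cat"
    and G :: "'g monoid" and H :: "'h monoid"
    and X :: "'x set" and \<alpha> :: "'h \<Rightarrow> 'x \<Rightarrow> 'x"
  assumes "pmet_subcategory S"
    and "nontrivial_group_actions TYPE('g) S"
    and "bornological_cartesian_powers TYPE('x) S"
    and "group G" and "carrier G \<noteq> {\<one>\<^bsub>G\<^esub>}"
    and "group H"
    and "group_action H X \<alpha>" and "X \<noteq> {}"
  shows "property_B S (wreath_product G H X \<alpha>) \<longleftrightarrow>
    property_B S G \<and> property_B S H \<and> finite X"
proof
  let ?W = "wreath_product G H X \<alpha>"
  assume B: "property_B S ?W"
  have A2: "finite_cartesian_powers S" and A3: "infinite_cartesian_powers TYPE('x) S"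
    using assms(3) by (simp_all add: bornological_cartesian_powers_def)
  have "finite X"
    using finite_if_property_B_wreath_product[OF assms(1,2) A3 assms(4,5,7) B] .
  moreover have "property_B S G"
    using property_B_left_if_property_B_wreath_product
      [OF assms(1) A2 assms(4,7) \<open>finite X\<close> assms(8) B] .
  moreover have "property_B S H"
  proof (rule property_B_quotient[OF assms(1) _ assms(6) B snd_hom_wreath_product])
    show "group ?W" using group_wreath_product[OF assms(4,7)] .
    have "(\<lambda>h. (\<lambda>x\<in>X. \<one>\<^bsub>G\<^esub>, h)) \<in> hom H ?W"
      using hom_into_wreath_product_right[OF assms(4,7)] .
    then show "carrier H \<subseteq> snd ` carrier ?W"
      by (force dest: hom_in_carrier)
  qed
  ultimately show "property_B S G \<and> property_B S H \<and> finite X" by blast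
next
  assume "property_B S G \<and> property_B S H \<and> finite X"
  then show "property_B S (wreath_product G H X \<alpha>)"
    using property_B_wreath_product_finite[OF assms(1,4,7)] by blast
qed

end
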